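(* Let $\widehat F:\mathbb R^N\to\mathbb R^N$ be continuously differentiable and put $$\underline\sigma=\inf_{U\in\mathbb R^N}\sigma_{\min}(D\widehat F(U)),\qquad\overline\sigma=\sup_{U\in\mathbb R^N}\sigma_{\max}(D\widehat F(U)).$$ Assume $0<\underline\sigma\le\overline\sigma<\infty$ and put $\kappa=\overline\sigma/\underline\sigma$. Then one can choose parameters $\gamma,\epsilon>0$ such that for every solution $(U_t,Q_t)_{t\ge0}$ of the PDHG flow $$\dot Q=-\epsilon Q+\widehat F(U),\qquad\dot U=-D\widehat F(U)^\top\big((1-\gamma\epsilon)Q+\gamma\widehat F(U)\big)$$ with arbitrary initial position $(U_0,Q_0)$, the residual $\|\widehat F(U_t)\|$ decays exponentially fast to $0$. In particular, if $\epsilon=(1-\delta)\kappa$ and $\gamma=\frac{1-\delta}{\kappa}$ with $|\delta|<\frac1\kappa$, then for all $t\ge0$ $$\|\widehat F(U_t)\|\le\exp\Big(-(1-\kappa|\delta|)(3-\delta)\frac{\min\{\underline\sigma^2,1\}}{8\kappa}\,t\Big)\sqrt{\|\widehat F(U_0)\|^2+\underline\sigma^2\|Q_0\|^2}.$$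
   Context: $\|\cdot\|$ is the Euclidean norm; $\sigma_{\min}(A),\sigma_{\max}(A)$ are the smallest and largest singular values of a matrix $A$; $D\widehat F(U)$ is the Jacobian matrix of $\widehat F$ at $U$. $U$ and $Q$ take values in $\mathbb R^N$. *)

theory Defs
  imports "HOL-Analysis.Analysis"
begin

definition singular_values :: "real ^ 'n ^ 'n \<Rightarrow> real set" where
  "singular_values A =
    {sqrt \<mu> |\<mu>. \<exists>v. v \<noteq> 0 \<and> (transpose A ** A) *v v = \<mu> *\<^sub>R v}"

(* The set of singular values is finite and, by the spectral theorem, nonempty,
   so Min and Max are well defined. *)

definition sigma_min :: "real ^ 'n ^ 'n \<Rightarrow> real" where
  "sigma_min A = Min (singular_values A)"

definition sigma_max :: "real ^ 'n ^ 'n \<Rightarrow> real" where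
  "sigma_max A = Max (singular_values A)"

definition continuously_differentiable :: "(real ^ 'n \<Rightarrow> real ^ 'n) \<Rightarrow> bool" where
  "continuously_differentiable F \<longleftrightarrow>
    (\<forall>U. F differentiable (at U)) \<and> continuous_on UNIV (\<lambda>U. jacobian F (at U))"

(* The curves are total functions of time, but only their values at t \<ge> 0 matter:
   at t = 0 the derivative is the one-sided one. *)

definition pdhg_flow ::
  "(real ^ 'n \<Rightarrow> real ^ 'n) \<Rightarrow> real \<Rightarrow> real \<Rightarrow>
    (real \<Rightarrow> real ^ 'n) \<Rightarrow> (real \<Rightarrow> real ^ 'n) \<Rightarrow> bool" where
  "pdhg_flow F \<gamma> \<epsilon> U Q \<longleftrightarrow>
    (\<forall>t\<ge>0.
      (Q has_vector_derivative (- (\<epsilon> *\<^sub>R Q t) + F (U t))) (at t within {0..}) \<and>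
      (U has_vector_derivative
        - (transpose (jacobian F (at (U t))) *v
            ((1 - \<gamma> * \<epsilon>) *\<^sub>R Q t + \<gamma> *\<^sub>R F (U t)))) (at t within {0..}))"

end

(* The proof shows that V = |F(U)|^2 + sl^2 |Q|^2 satisfies V' <= -2 rho V, where rho is the claimed rate.
   Along the flow, -V'/2 - rho V is a quadratic form in (F(U), Q) that is affine in the matrix
   A = J J^T, where J is the Jacobian. Since sl^2 I <= A <= su^2 I, it is an average of its
   values at A = sl^2 I and A = su^2 I with the positive semidefinite operator weights su^2 I - A and
   A - sl^2 I, so nonnegativity reduces to a discriminant condition for two binary
   quadratic forms. That discriminant factors, and |delta| < 1/kappa is exactly what makes it positive. *)

theory Submission
  imports Defs
begin

section \<open>Singular values and norm bounds\<close>

lemma inner_matrix_vector_transpose: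
  fixes A :: "real ^ 'n ^ 'm"
  shows "x \<bullet> (A *v y) = (transpose A *v x) \<bullet> y"
  by (simp add: dot_lmul_matrix transpose_matrix_vector)

lemma inner_gram_matrix:
  fixes A :: "real ^ 'n ^ 'm"
  shows "x \<bullet> ((transpose A ** A) *v y) = (A *v x) \<bullet> (A *v y)"
  by (metis inner_matrix_vector_transpose matrix_vector_mul_assoc transpose_transpose)

text \<open>Minimise the quadratic form of \<open>S\<close> over the compact unit sphere. The
  residual \<open>S *v v - \<mu> *\<^sub>R v\<close> at a minimiser \<open>v\<close> must vanish,
  since otherwise a small step against it would make the form of \<open>S - \<mu> I\<close>
  negative.\<close>

lemma symmetric_smallest_eigenvalue:
  fixes S :: "real ^ 'n ^ 'n"
  assumes sym: "\<And>x y. x \<bullet> (S *v y) = (S *v x) \<bullet> y"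
  obtains v \<mu> where "v \<noteq> 0" "S *v v = \<mu> *\<^sub>R v" "\<And>x. \<mu> * (norm x)\<^sup>2 \<le> x \<bullet> (S *v x)"
proof -
  have cont: "continuous_on (sphere 0 1) (\<lambda>x. x \<bullet> (S *v x))"
    by (intro continuous_intros linear_continuous_on matrix_vector_mul_bounded_linear)
  obtain v where v: "v \<in> sphere (0 :: real ^ 'n) 1"
    and min: "\<And>x. x \<in> sphere 0 1 \<Longrightarrow> v \<bullet> (S *v v) \<le> x \<bullet> (S *v x)"
    using continuous_attains_inf[OF compact_sphere _ cont] by fastforce
  define \<mu> where "\<mu> = v \<bullet> (S *v v)"
  \<comment> \<open>The form of \<open>S - \<mu> I\<close>: nonnegative everywhere by homogeneity
    and zero at \<open>v\<close>.\<close>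
  define f where "f x = x \<bullet> (S *v x) - \<mu> * (x \<bullet> x)" for x
  have v1: "v \<bullet> v = 1"
    using v by (simp add: dot_square_norm)
  have f0: "0 \<le> f x" for x
  proof (cases "x = 0")
    case False
    have "\<mu> \<le> (x /\<^sub>R norm x) \<bullet> (S *v (x /\<^sub>R norm x))"
      unfolding \<mu>_def using False by (intro min) simp
    also have "\<dots> = x \<bullet> (S *v x) / (norm x)\<^sup>2"
      by (simp add: matrix_vector_mult_scaleR power2_eq_square divide_simps)
    finally show ?thesis
      using False by (simp add: f_def dot_square_norm field_simps)
  qed (simp add: f_def)
  define w where "w = S *v v - \<mu> *\<^sub>R v"
  \<comment> \<open>The step length makes the quadratic term \<open>t\<^sup>2 * f w\<close> at most
    \<open>t * (w \<bullet> w)\<close>, half of the linear gain; the \<open>+ 1\<close> keeps the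
    denominator positive when \<open>f w = 0\<close>.\<close>
  define t where "t = (w \<bullet> w) / (f w + 1)"
  have "f (v - t *\<^sub>R w) = - (2 * t * (w \<bullet> w)) + t\<^sup>2 * f w"
  proof -
    have "v \<bullet> (S *v w) = w \<bullet> (S *v v)"
      by (metis sym inner_commute)
    moreover have "w \<bullet> (S *v v) = w \<bullet> w + \<mu> * (w \<bullet> v)"
      by (metis diff_add_cancel inner_add_right inner_scaleR_right w_def)
    ultimately show ?thesis
      using v1 unfolding f_def
      by (simp add: \<mu>_def matrix_vector_mult_diff_distrib matrix_vector_mult_scaleR inner_diff_left
          inner_diff_right inner_commute[of v w] power2_eq_square algebra_simps)
  qed
  also have "\<dots> \<le> - t * (w \<bullet> w)"
  proof -
    have t0: "t * (f w + 1) = w \<bullet> w" "0 \<le> t"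
      using f0[of w] by (simp_all add: t_def)
    then have "t * (t * f w) \<le> t * (w \<bullet> w)"
      by (intro mult_left_mono) (simp_all add: algebra_simps)
    then show ?thesis by (simp add: power2_eq_square)
  qed
  finally have "t * (w \<bullet> w) \<le> 0"
    using f0[of "v - t *\<^sub>R w"] by simp
  then have "w = 0"
    using f0[of w] unfolding t_def by (smt (verit) inner_gt_zero_iff divide_pos_pos mult_pos_pos)
  show ?thesis
  proof
    show "v \<noteq> 0" using v by auto
    show "S *v v = \<mu> *\<^sub>R v" using \<open>w = 0\<close> by (simp add: w_def)
    show "\<mu> * (norm x)\<^sup>2 \<le> x \<bullet> (S *v x)" for x
      using f0[of x] by (simp add: f_def dot_square_norm)
  qed
qed

text \<open>Eigenvectors for distinct eigenvalues are orthogonal, so choosing one per eigenvalue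
  gives an independent set, which is finite in finite dimension.\<close>

lemma finite_eigenvalues_symmetric:
  fixes S :: "real ^ 'n ^ 'n"
  assumes sym: "\<And>x y. x \<bullet> (S *v y) = (S *v x) \<bullet> y"
  shows "finite {\<mu>. \<exists>v. v \<noteq> 0 \<and> S *v v = \<mu> *\<^sub>R v}" (is "finite ?E")
proof -
  define e where "e \<mu> = (SOME v. v \<noteq> 0 \<and> S *v v = \<mu> *\<^sub>R v)" for \<mu>
  have e: "e \<mu> \<noteq> 0" "S *v e \<mu> = \<mu> *\<^sub>R e \<mu>" if "\<mu> \<in> ?E" for \<mu>
    using that someI_ex[of "\<lambda>v. v \<noteq> 0 \<and> S *v v = \<mu> *\<^sub>R v"] unfolding e_def by auto
  have orth: "e \<mu> \<bullet> e \<nu> = 0" if "\<mu> \<in> ?E" "\<nu> \<in> ?E" "\<mu> \<noteq> \<nu>" for \<mu> \<nu>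
    using sym[of "e \<mu>" "e \<nu>"] e(2)[OF that(1)] e(2)[OF that(2)] that(3) by simp
  have inj: "inj_on e ?E"
    using orth e(1) by (metis (no_types, lifting) inj_onI inner_eq_zero_iff)
  have "independent (e ` ?E)"
  proof (rule pairwise_orthogonal_independent)
    show "pairwise orthogonal (e ` ?E)"
      using orth by (auto simp: pairwise_def orthogonal_def)
    show "0 \<notin> e ` ?E"
      using e(1) by force
  qed
  then show ?thesis
    using inj independent_bound finite_imageD by blast
qed

section \<open>Extreme singular values as norm bounds\<close>

lemma finite_singular_values: "finite (singular_values A)"
proof -
  have "singular_values A = sqrt ` {\<mu>. \<exists>v. v \<noteq> 0 \<and> (transpose A ** A) *v v = \<mu> *\<^sub>R v}"
    by (auto simp: singular_values_def)
  then show ?thesis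
    using finite_eigenvalues_symmetric[of "transpose A ** A"]
    by (simp add: inner_gram_matrix inner_commute[of "(transpose A ** A) *v _"])
      (simp add: inner_commute)
qed

text \<open>\<open>sqrt\<close> is negative on negative reals, so the sign has to come from the
  eigenvalue: \<open>\<mu> * (v \<bullet> v)\<close> is the squared norm of
  \<open>A *v v\<close>.\<close>

lemma singular_values_nonneg:
  assumes "s \<in> singular_values A"
  shows "0 \<le> s"
proof -
  obtain \<mu> v where s: "s = sqrt \<mu>" and v: "v \<noteq> 0" "(transpose A ** A) *v v = \<mu> *\<^sub>R v"
    using assms by (auto simp: singular_values_def)
  have "\<mu> * (v \<bullet> v) = (A *v v) \<bullet> (A *v v)"
    using inner_gram_matrix[of v A v] v by simp
  then have "0 \<le> \<mu>"
    using v(1) by (metis inner_ge_zero inner_gt_zero_iff linorder_not_le mult_neg_pos)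
  then show ?thesis by (simp add: s)
qed

text \<open>The root of the smallest eigenvalue of the Gram matrix is itself a singular value. Hence
  the minimum is taken over a nonempty set and lies below this root, which bounds
  \<open>norm (A *v x) / norm x\<close> from below.\<close>

lemma sigma_min_bounds:
  fixes A :: "real ^ 'n ^ 'n"
  shows sigma_min_nonneg: "0 \<le> sigma_min A"
    and sigma_min_le: "sigma_min A * norm x \<le> norm (A *v x)"
proof -
  obtain v \<mu> where v: "v \<noteq> 0" "(transpose A ** A) *v v = \<mu> *\<^sub>R v"
    and le: "\<And>x. \<mu> * (norm x)\<^sup>2 \<le> x \<bullet> ((transpose A ** A) *v x)"
    by (rule symmetric_smallest_eigenvalue[of "transpose A ** A"])
      (simp add: inner_gram_matrix inner_commute[of "(transpose A ** A) *v _"]; simp add: inner_commute)+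
  have mem: "sqrt \<mu> \<in> singular_values A"
    using v by (auto simp: singular_values_def)
  then have "singular_values A \<noteq> {}" by blast
  then show 0: "0 \<le> sigma_min A"
    by (simp add: sigma_min_def finite_singular_values singular_values_nonneg)
  have "sigma_min A \<le> sqrt \<mu>"
    by (simp add: sigma_min_def finite_singular_values mem)
  then have "sigma_min A * norm x \<le> sqrt \<mu> * norm x"
    by (simp add: mult_right_mono)
  also have "\<dots> = sqrt (\<mu> * (norm x)\<^sup>2)"
    by (simp add: real_sqrt_mult)
  also have "\<dots> \<le> norm (A *v x)"
    using le[of x] by (simp add: inner_gram_matrix dot_square_norm real_le_lsqrt)
  finally show "sigma_min A * norm x \<le> norm (A *v x)" .
qed

text \<open>The smallest-eigenvalue lemma is applied to the negated Gram matrix, so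
  \<open>- \<mu>\<close> is the largest eigenvalue of the Gram matrix.\<close>

lemma sigma_max_ge:
  fixes A :: "real ^ 'n ^ 'n"
  shows "norm (A *v x) \<le> sigma_max A * norm x"
proof -
  have minus: "(- (transpose A ** A)) *v y = - ((transpose A ** A) *v y)" for y
    by (metis (no_types, lifting) ab_left_minus add_eq_0_iff matrix_vector_mult_0
        matrix_vector_mult_add_rdistrib)
  obtain v \<mu> where v: "v \<noteq> 0" "(- (transpose A ** A)) *v v = \<mu> *\<^sub>R v"
    and le: "\<And>x. \<mu> * (norm x)\<^sup>2 \<le> x \<bullet> ((- (transpose A ** A)) *v x)"
    by (rule symmetric_smallest_eigenvalue[of "- (transpose A ** A)"])
      (simp add: minus inner_gram_matrix inner_commute[of "(transpose A ** A) *v _"]; simp add: inner_commute)+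
  have "(transpose A ** A) *v v = (- \<mu>) *\<^sub>R v"
    using v(2) by (simp add: minus minus_equation_iff[of "_ *v _"])
  then have mem: "sqrt (- \<mu>) \<in> singular_values A"
    using v(1) by (auto simp: singular_values_def)
  have "norm (A *v x) \<le> sqrt (- \<mu> * (norm x)\<^sup>2)"
    using le[of x] by (intro real_le_rsqrt) (simp add: minus inner_gram_matrix dot_square_norm)
  also have "\<dots> = sqrt (- \<mu>) * norm x"
    by (simp only: real_sqrt_mult real_sqrt_abs2 real_sqrt_abs abs_norm_cancel)
  also have "\<dots> \<le> sigma_max A * norm x"
    by (simp add: sigma_max_def finite_singular_values mem mult_right_mono)
  finally show ?thesis .
qed

section \<open>Transfer of norm bounds to the transpose\<close>

lemma norm_transpose_le:
  fixes A :: "real ^ 'n ^ 'm"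
  assumes "\<And>x. norm (A *v x) \<le> c * norm x"
  shows "norm (transpose A *v x) \<le> c * norm x"
proof (cases "transpose A *v x = 0")
  case True
  \<comment> \<open>In this case the claim needs \<open>0 \<le> c\<close>; testing the assumption on
    a unit coordinate vector supplies it.\<close>
  have "0 \<le> norm (A *v axis undefined 1)" by simp
  also have "\<dots> \<le> c" using assms[of "axis undefined 1"] by simp
  finally show ?thesis unfolding True by simp
next
  case False
  have "(norm (transpose A *v x))\<^sup>2 = x \<bullet> (A *v (transpose A *v x))"
    by (simp add: inner_matrix_vector_transpose dot_square_norm)
  also have "\<dots> \<le> norm x * norm (A *v (transpose A *v x))"
    by (rule norm_cauchy_schwarz)
  also have "\<dots> \<le> norm x * (c * norm (transpose A *v x))"
    by (intro mult_left_mono assms) simp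
  finally show ?thesis
    using False by (simp add: power2_eq_square algebra_simps)
qed

text \<open>A square matrix bounded below is injective, hence surjective. Writing
  \<open>x = A *v y\<close> with \<open>c * norm y \<le> norm x\<close>, Cauchy-Schwarz for the
  pairing of \<open>transpose A *v x\<close> with \<open>y\<close> gives the bound.\<close>

lemma norm_transpose_ge:
  fixes A :: "real ^ 'n ^ 'n"
  assumes "0 < c" and ge: "\<And>x. c * norm x \<le> norm (A *v x)"
  shows "c * norm x \<le> norm (transpose A *v x)"
proof -
  have "inj ((*v) A)"
    by (rule linear_injective_0[THEN iffD2])
      (use \<open>0 < c\<close> ge in \<open>auto simp: matrix_vector_mul_linear mult_le_0_iff dest: spec\<close>,
        metis \<open>0 < c\<close> linorder_not_le mult_pos_pos norm_zero zero_less_norm_iff)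
  then have "surj ((*v) A)"
    by (rule linear_injective_imp_surjective[OF matrix_vector_mul_linear]) simp
  then obtain y where y: "x = A *v y" by (meson surjD)
  show ?thesis
  proof (cases "x = 0")
    case False
    have "(norm x)\<^sup>2 = (transpose A *v x) \<bullet> y"
      using y by (metis inner_matrix_vector_transpose dot_square_norm)
    also have "\<dots> \<le> norm (transpose A *v x) * norm y"
      by (rule norm_cauchy_schwarz)
    finally have "c * (norm x)\<^sup>2 \<le> norm (transpose A *v x) * (c * norm y)"
      using \<open>0 < c\<close> by (simp add: mult.left_commute)
    also have "\<dots> \<le> norm (transpose A *v x) * norm x"
      using ge[of y] y by (intro mult_left_mono) simp_all
    finally show ?thesis
      using False by (simp add: power2_eq_square)
  qed simp
qed

section \<open>Quadratic forms\<close>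

text \<open>Completing the square: \<open>4 * p\<close> times the expression is the semidefinite
  form at \<open>(2 * p) *\<^sub>R x + m *\<^sub>R y\<close> plus
  \<open>4 * p * r - m\<^sup>2\<close> times its value at \<open>y\<close>. If \<open>p = 0\<close>,
  the discriminant condition forces \<open>m = 0\<close>. The parameters \<alpha>, \<beta> let the
  form be either of the two operator weights used below.\<close>

lemma binary_form_nonneg:
  fixes x y :: "'a :: real_inner" and T :: "'a \<Rightarrow> 'b :: real_inner"
  assumes T: "linear T" and psd: "\<And>z. 0 \<le> \<alpha> * (z \<bullet> z) + \<beta> * (T z \<bullet> T z)"
    and pr: "0 \<le> p" "0 \<le> r" and disc: "m\<^sup>2 \<le> 4 * p * r"
  shows "0 \<le> p * (\<alpha> * (x \<bullet> x) + \<beta> * (T x \<bullet> T x)) + m * (\<alpha> * (x \<bullet> y) + \<beta> * (T x \<bullet> T y))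
           + r * (\<alpha> * (y \<bullet> y) + \<beta> * (T y \<bullet> T y))"
proof (cases "p = 0")
  case True
  then show ?thesis using disc psd[of y] pr by simp
next
  case False
  let ?\<phi> = "\<lambda>z. \<alpha> * (z \<bullet> z) + \<beta> * (T z \<bullet> T z)"
  let ?b = "\<alpha> * (x \<bullet> y) + \<beta> * (T x \<bullet> T y)"
  have "?\<phi> ((2 * p) *\<^sub>R x + m *\<^sub>R y) = 4 * p\<^sup>2 * ?\<phi> x + 4 * p * m * ?b + m\<^sup>2 * ?\<phi> y"
    by (simp add: linear_add[OF T] linear_scale[OF T] inner_add_left inner_add_right inner_commute
        power2_eq_square algebra_simps)
  moreover have "0 \<le> ?\<phi> ((2 * p) *\<^sub>R x + m *\<^sub>R y)" by (rule psd)
  moreover have "0 \<le> (4 * p * r - m\<^sup>2) * ?\<phi> y"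
    using disc psd[of y] by simp
  ultimately have "0 \<le> 4 * p * (p * ?\<phi> x + m * ?b + r * ?\<phi> y)"
    by (simp add: power2_eq_square algebra_simps)
  then show ?thesis
    using False pr(1) by (simp add: zero_le_mult_iff)
qed

text \<open>Write \<open>A\<close> for the adjoint of \<open>T\<close> composed with
  \<open>T\<close>. A coefficient c(l) affine in l satisfies (b - a) c(A) = c(a) (b I - A) + c(b) (A
  - a I), and both weights are positive semidefinite, so each summand falls under the binary
  lemma.\<close>

lemma interpolated_form_nonneg:
  fixes x y :: "'a :: real_inner" and T :: "'a \<Rightarrow> 'b :: real_inner"
  assumes T: "linear T" and "a \<le> b"
    and lo: "\<And>z. a * (z \<bullet> z) \<le> T z \<bullet> T z" and hi: "\<And>z. T z \<bullet> T z \<le> b * (z \<bullet> z)"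
    and r: "0 \<le> r"
    and p: "\<And>l. l \<in> {a, b} \<Longrightarrow> 0 \<le> p1 * l + p0"
    and disc: "\<And>l. l \<in> {a, b} \<Longrightarrow> (m1 * l + m0)\<^sup>2 \<le> 4 * (p1 * l + p0) * r"
  shows "0 \<le> p1 * (T x \<bullet> T x) + p0 * (x \<bullet> x) + m1 * (T x \<bullet> T y) + m0 * (x \<bullet> y) + r * (y \<bullet> y)"
    (is "0 \<le> ?V")
proof (cases "a = b")
  case True
  \<comment> \<open>Both weights degenerate when \<open>a = b\<close>; then \<open>T\<close> scales
    all inner products by \<open>a\<close>, by polarization, and the plain inner product serves as
    the form.\<close>
  have eq: "T z \<bullet> T z = a * (z \<bullet> z)" for z
    using lo[of z] hi[of z] True by simp
  have "T x \<bullet> T y = a * (x \<bullet> y)"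
    using eq[of "x + y"] eq[of x] eq[of y]
    by (simp add: linear_add[OF T] inner_add_left inner_add_right inner_commute algebra_simps)
  then have "?V = (p1 * a + p0) * (x \<bullet> x) + (m1 * a + m0) * (x \<bullet> y) + r * (y \<bullet> y)"
    by (simp add: eq algebra_simps)
  then show ?thesis
    using binary_form_nonneg[OF T, of 1 0 "p1 * a + p0" r "m1 * a + m0" x y] p[of a] disc[of a] r
    by simp
next
  case False
  have "0 \<le> (p1 * a + p0) * (b * (x \<bullet> x) + (-1) * (T x \<bullet> T x))
      + (m1 * a + m0) * (b * (x \<bullet> y) + (-1) * (T x \<bullet> T y))
      + r * (b * (y \<bullet> y) + (-1) * (T y \<bullet> T y))"
    using p[of a] disc[of a] r hi by (intro binary_form_nonneg[OF T]) auto
  moreover have "0 \<le> (p1 * b + p0) * ((- a) * (x \<bullet> x) + 1 * (T x \<bullet> T x))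
      + (m1 * b + m0) * ((- a) * (x \<bullet> y) + 1 * (T x \<bullet> T y))
      + r * ((- a) * (y \<bullet> y) + 1 * (T y \<bullet> T y))"
    using p[of b] disc[of b] r lo by (intro binary_form_nonneg[OF T]) auto
  ultimately have "0 \<le> (b - a) * ?V"
    by (simp add: algebra_simps)
  then show ?thesis
    using False \<open>a \<le> b\<close> by (simp add: zero_le_mult_iff)
qed

section \<open>The decay rate\<close>

text \<open>Here \<open>a * \<mu>\<^sup>2\<close> stands for an endpoint of the spectral interval,
  with \<mu> to be 1 or \<kappa>; \<open>P\<close> is \<gamma> times this endpoint and
  \<open>R\<close> is \<epsilon>. It suffices to bound \<open>\<rho> * (P + R)\<close> by the
  discriminant at rate zero.\<close>

lemma decay_rate_discriminant:
  fixes a \<kappa> \<delta> \<mu> :: real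
  assumes "0 < a" "1 \<le> \<mu>" "\<mu> \<le> \<kappa>" and \<delta>: "\<kappa> * \<bar>\<delta>\<bar> < 1"
  defines "\<rho> \<equiv> (1 - \<kappa> * \<bar>\<delta>\<bar>) * (3 - \<delta>) * (min a 1 / (8 * \<kappa>))"
    and "P \<equiv> (1 - \<delta>) / \<kappa> * (a * \<mu>\<^sup>2)" and "R \<equiv> (1 - \<delta>) * \<kappa>"
  shows "0 \<le> P - \<rho>" "0 \<le> R - \<rho>"
    and "(\<delta> * (2 - \<delta>) * (a * \<mu>\<^sup>2) - a)\<^sup>2 \<le> 4 * (P - \<rho>) * ((R - \<rho>) * a)"
proof -
  have \<kappa>: "1 \<le> \<kappa>" using assms by simp
  have d: "\<bar>\<delta>\<bar> < 1"
    using \<kappa> \<delta> mult_right_mono[of 1 \<kappa> "\<bar>\<delta>\<bar>"] by simp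
  have PR: "0 < P" "0 < R"
    using d \<kappa> assms by (simp_all add: P_def R_def)
  have \<rho>0: "0 \<le> \<rho>"
    using d \<kappa> assms by (simp add: \<rho>_def)
  have "P + R \<le> (1 - \<delta>) * \<kappa> * (a + 1)"
  proof -
    have "a * \<mu>\<^sup>2 \<le> a * \<kappa>\<^sup>2"
      using assms by (intro mult_left_mono power_mono) auto
    then have "P \<le> (1 - \<delta>) / \<kappa> * (a * \<kappa>\<^sup>2)"
      unfolding P_def by (rule mult_left_mono) (use d \<kappa> in simp)
    also have "\<dots> = (1 - \<delta>) * \<kappa> * a"
      by (simp add: power2_eq_square)
    finally show ?thesis
      by (simp add: R_def algebra_simps)
  qed
  then have "\<rho> * (P + R) \<le> \<rho> * ((1 - \<delta>) * \<kappa> * (a + 1))"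
    using \<rho>0 by (rule mult_left_mono)
  also have "\<dots> = (1 - \<kappa> * \<bar>\<delta>\<bar>) * (3 - \<delta>) * (1 - \<delta>) / 8 * (min a 1 * (a + 1))"
    using \<kappa> by (simp add: \<rho>_def field_simps)
  also have "\<dots> \<le> (1 - \<kappa> * \<bar>\<delta>\<bar>) * (3 - \<delta>) * (1 - \<delta>) / 8 * (2 * a)"
  \<comment> \<open>This loss of a factor 2, together with the 1/4 in the discriminant, accounts for
    the 8 in the rate.\<close>
  proof (rule mult_left_mono)
    show "min a 1 * (a + 1) \<le> 2 * a"
      using \<open>0 < a\<close> by (cases "a \<le> 1") (auto simp: min_def)
  qed (use d \<delta> in auto)
  also have "\<dots> = a / 4 * ((1 - \<kappa> * \<bar>\<delta>\<bar>) * ((3 - \<delta>) * (1 - \<delta>)))"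
    by simp
  \<comment> \<open>The factors are compared separately. The first uses that the absolute value of
    \<open>\<delta> * \<mu>\<close> is at most \<open>\<kappa> * \<bar>\<delta>\<bar>\<close>, which
    is below 1. The second uses \<open>1 \<le> \<mu>\<close> and (3 - \<delta>)(1 - \<delta>) = (2 -
    \<delta>)^2 - 1, the origin of \<open>3 - \<delta>\<close> in the rate.\<close>
  also have "\<dots> \<le> a / 4 * ((1 - (\<delta> * \<mu>)\<^sup>2) * (((2 - \<delta>) * \<mu>)\<^sup>2 - 1))"
  proof (intro mult_left_mono mult_mono)
    have dm: "\<bar>\<delta> * \<mu>\<bar> \<le> \<kappa> * \<bar>\<delta>\<bar>"
      using assms mult_right_mono[of \<mu> \<kappa> "\<bar>\<delta>\<bar>"] by (simp add: abs_mult mult.commute)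
    then have "\<bar>\<delta> * \<mu>\<bar> * \<bar>\<delta> * \<mu>\<bar> \<le> \<kappa> * \<bar>\<delta>\<bar> * 1"
      using \<delta> by (intro mult_mono) auto
    then show "1 - \<kappa> * \<bar>\<delta>\<bar> \<le> 1 - (\<delta> * \<mu>)\<^sup>2"
      by (simp add: power2_eq_square abs_mult_self_eq)
    then show "0 \<le> 1 - (\<delta> * \<mu>)\<^sup>2"
      using \<delta> by simp
    have "2 - \<delta> \<le> (2 - \<delta>) * \<mu>"
      using d assms mult_left_mono[of 1 \<mu> "2 - \<delta>"] by simp
    then have "(2 - \<delta>)\<^sup>2 \<le> ((2 - \<delta>) * \<mu>)\<^sup>2"
      using d by (intro power_mono) auto
    then show "(3 - \<delta>) * (1 - \<delta>) \<le> ((2 - \<delta>) * \<mu>)\<^sup>2 - 1"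
      by (simp add: power2_eq_square algebra_simps)
  qed (use d \<open>0 < a\<close> in auto)
  \<comment> \<open>With s = \<delta> \<mu> and u = (2 - \<delta>) \<mu> this is (1 - s^2)(u^2 - 1)
    = (u - s)^2 - (s u - 1)^2, where u - s = 2 (1 - \<delta>) \<mu>.\<close>
  also have "\<dots> = P * R - a / 4 * (\<delta> * (2 - \<delta>) * \<mu>\<^sup>2 - 1)\<^sup>2"
  proof -
    have "P * R = (1 - \<delta>)\<^sup>2 * (a * \<mu>\<^sup>2)"
      using \<kappa> by (simp add: P_def R_def power2_eq_square)
    then show ?thesis
      by (simp add: power2_eq_square field_simps)
  qed
  finally have key: "\<rho> * (P + R) \<le> P * R - a / 4 * (\<delta> * (2 - \<delta>) * \<mu>\<^sup>2 - 1)\<^sup>2" .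
  have "0 \<le> a / 4 * (\<delta> * (2 - \<delta>) * \<mu>\<^sup>2 - 1)\<^sup>2"
    using \<open>0 < a\<close> by simp
  with key have PRle: "\<rho> * P + \<rho> * R \<le> P * R"
    by (simp add: algebra_simps)
  have "0 \<le> \<rho> * P" "0 \<le> \<rho> * R"
    using PR \<rho>0 by simp_all
  with PRle have "\<rho> * R \<le> P * R" "\<rho> * P \<le> R * P"
    using mult.commute[of P R] by linarith+
  then show "0 \<le> P - \<rho>" "0 \<le> R - \<rho>"
    using PR by simp_all
  have "a / 4 * (\<delta> * (2 - \<delta>) * \<mu>\<^sup>2 - 1)\<^sup>2 \<le> P * R - \<rho> * (P + R)"
    using key by linarith
  \<comment> \<open>The two sides differ by the square of \<rho>.\<close>
  also have "\<dots> \<le> (P - \<rho>) * (R - \<rho>)"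
    by (simp add: algebra_simps)
  finally have "4 * a * (a / 4 * (\<delta> * (2 - \<delta>) * \<mu>\<^sup>2 - 1)\<^sup>2) \<le> 4 * a * ((P - \<rho>) * (R - \<rho>))"
    using \<open>0 < a\<close> by (intro mult_left_mono) auto
  then show "(\<delta> * (2 - \<delta>) * (a * \<mu>\<^sup>2) - a)\<^sup>2 \<le> 4 * (P - \<rho>) * ((R - \<rho>) * a)"
    by (simp add: power2_eq_square algebra_simps)
qed

text \<open>Gronwall's argument: \<open>exp (k * u) * V u\<close> has nonpositive
  derivative.\<close>

lemma exponential_decay:
  fixes V V' :: "real \<Rightarrow> real"
  assumes der: "\<And>t. 0 \<le> t \<Longrightarrow> (V has_real_derivative V' t) (at t within {0..})"
    and le: "\<And>t. 0 \<le> t \<Longrightarrow> V' t \<le> - k * V t" and "0 \<le> t"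
  shows "V t \<le> exp (- k * t) * V 0"
proof (cases "t = 0")
  case False
  define W where "W u = exp (k * u) * V u" for u
  have W: "(W has_real_derivative exp (k * u) * (k * V u + V' u)) (at u within {0..})"
    if "0 \<le> u" for u
    unfolding W_def
    by (rule derivative_eq_intros der that refl | simp add: algebra_simps)+
  \<comment> \<open>The sign of the derivative is needed only on the open interval, where the
    one-sided derivative is a full one; at the endpoints continuity suffices.\<close>
  have "W t \<le> W 0"
  proof (rule DERIV_nonpos_imp_decreasing_open[where f = W and a = 0 and b = t])
    show "continuous_on {0..t} W"
      by (rule continuous_on_subset[OF DERIV_continuous_on[of "{0..}"]]) (auto intro: W)
    fix u :: real assume "0 < u" "u < t"
    then have "at u within {0..} = at u"
      by (intro at_within_interior) simp
    then have "(W has_real_derivative exp (k * u) * (k * V u + V' u)) (at u)"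
      using W[of u] \<open>0 < u\<close> by simp
    moreover have "exp (k * u) * (k * V u + V' u) \<le> 0"
      using le[of u] \<open>0 < u\<close> by (simp add: mult_le_0_iff)
    ultimately show "\<exists>y. (W has_real_derivative y) (at u) \<and> y \<le> 0" by blast
  qed (use \<open>0 \<le> t\<close> in simp)
  then show ?thesis
    by (simp add: W_def exp_minus field_simps)
qed simp

section \<open>The PDHG flow\<close>

text \<open>The chain rule brings in the Jacobian times its transpose, the symmetric matrix on which
  the estimate depends.\<close>

lemma pdhg_flow_residual_derivative:
  fixes F :: "real ^ 'n \<Rightarrow> real ^ 'n"
  assumes "continuously_differentiable F" and "pdhg_flow F \<gamma> \<epsilon> U Q" and "0 \<le> t"
  shows "((\<lambda>t. F (U t)) has_vector_derivative
      - (jacobian F (at (U t)) *v (transpose (jacobian F (at (U t))) *v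
            ((1 - \<gamma> * \<epsilon>) *\<^sub>R Q t + \<gamma> *\<^sub>R F (U t))))) (at t within {0..})"
proof -
  let ?J = "jacobian F (at (U t))"
  let ?u = "- (transpose ?J *v ((1 - \<gamma> * \<epsilon>) *\<^sub>R Q t + \<gamma> *\<^sub>R F (U t)))"
  have U: "(U has_vector_derivative ?u) (at t within {0..})"
    using assms by (simp add: pdhg_flow_def)
  have "(F has_derivative (*v) ?J) (at (U t))"
    using assms(1) by (simp add: continuously_differentiable_def flip: jacobian_works)
  then have "(F has_derivative (*v) ?J) (at (U t) within U ` {0..})"
    by (rule has_derivative_at_withinI)
  then have "((F \<circ> U) has_vector_derivative ?J *v ?u) (at t within {0..})"
    by (rule vector_derivative_diff_chain_within[OF U])
  moreover have "?J *v ?u = - (?J *v (transpose ?J *v ((1 - \<gamma> * \<epsilon>) *\<^sub>R Q t + \<gamma> *\<^sub>R F (U t))))"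
    using linear_neg[OF matrix_vector_mul_linear[of ?J]] by simp
  ultimately show ?thesis
    by (simp add: o_def)
qed

text \<open>The Lyapunov argument itself, stated with uniform two-sided norm bounds on the Jacobian
  so that the infimum and supremum enter only in the final theorem.\<close>

lemma pdhg_flow_decay:
  fixes F :: "real ^ 'n \<Rightarrow> real ^ 'n"
  assumes F: "continuously_differentiable F"
    and \<sigma>l: "0 < \<sigma>l" "\<sigma>l \<le> \<sigma>u"
    and lo: "\<And>U x. \<sigma>l * norm x \<le> norm (jacobian F (at U) *v x)"
    and hi: "\<And>U x. norm (jacobian F (at U) *v x) \<le> \<sigma>u * norm x"
    and \<kappa>: "\<kappa> = \<sigma>u / \<sigma>l" and \<delta>: "\<bar>\<delta>\<bar> < 1 / \<kappa>"
    and \<epsilon>: "\<epsilon> = (1 - \<delta>) * \<kappa>" and \<gamma>: "\<gamma> = (1 - \<delta>) / \<kappa>"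
    and flow: "pdhg_flow F \<gamma> \<epsilon> U Q" and "0 \<le> t"
  shows "norm (F (U t)) \<le>
     exp (- ((1 - \<kappa> * \<bar>\<delta>\<bar>) * (3 - \<delta>) * (min (\<sigma>l\<^sup>2) 1 / (8 * \<kappa>)) * t)) *
       sqrt ((norm (F (U 0)))\<^sup>2 + \<sigma>l\<^sup>2 * (norm (Q 0))\<^sup>2)"
proof -
  define a where "a = \<sigma>l\<^sup>2"
  define \<rho> where "\<rho> = (1 - \<kappa> * \<bar>\<delta>\<bar>) * (3 - \<delta>) * (min a 1 / (8 * \<kappa>))"
  have a: "0 < a" and \<kappa>1: "1 \<le> \<kappa>" and b: "\<sigma>u\<^sup>2 = a * \<kappa>\<^sup>2"
    using \<sigma>l by (simp_all add: a_def \<kappa> power_divide)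
  have \<delta>': "\<kappa> * \<bar>\<delta>\<bar> < 1"
    using \<delta> \<kappa>1 by (simp add: field_simps)
  have \<gamma>\<epsilon>: "1 - \<gamma> * \<epsilon> = \<delta> * (2 - \<delta>)"
    using \<kappa>1 by (simp add: \<gamma> \<epsilon> field_simps)
  \<comment> \<open>The two endpoints: \<mu> = 1 gives \<open>a\<close>, and \<mu> = \<kappa> gives
    \<open>a * \<kappa>\<^sup>2 = \<sigma>u\<^sup>2\<close>.\<close>
  note disc1 = decay_rate_discriminant[OF a order_refl \<kappa>1 \<delta>', folded \<rho>_def \<gamma> \<epsilon>]
  note disc\<kappa> = decay_rate_discriminant[OF a \<kappa>1 order_refl \<delta>', folded \<rho>_def \<gamma> \<epsilon>]
  define J where "J t = jacobian F (at (U t))" for t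
  define V where "V t = F (U t) \<bullet> F (U t) + a * (Q t \<bullet> Q t)" for t
  define V' where "V' t = 2 * (F (U t) \<bullet> - (J t *v (transpose (J t) *v
            ((1 - \<gamma> * \<epsilon>) *\<^sub>R Q t + \<gamma> *\<^sub>R F (U t))))) + a * (2 * (Q t \<bullet> (- (\<epsilon> *\<^sub>R Q t) + F (U t))))" for t
  have der: "(V has_real_derivative V' t) (at t within {0..})" if "0 \<le> t" for t
  proof -
    note dF = pdhg_flow_residual_derivative[OF F flow that, folded J_def,
        unfolded has_vector_derivative_def]
    have dQ: "(Q has_derivative (\<lambda>h. h *\<^sub>R (- (\<epsilon> *\<^sub>R Q t) + F (U t)))) (at t within {0..})"
      using flow that by (simp add: pdhg_flow_def has_vector_derivative_def)
    show ?thesis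
      unfolding has_field_derivative_def V_def V'_def
      by (rule derivative_eq_intros dF dQ refl ext | simp add: inner_commute algebra_simps)+
  qed
  have le: "V' t \<le> - (2 * \<rho>) * V t" for t
  proof -
    let ?T = "(*v) (transpose (J t))" and ?f = "F (U t)" and ?q = "Q t"
    have Tlo: "a * (z \<bullet> z) \<le> ?T z \<bullet> ?T z" for z
    proof -
      have "\<sigma>l * norm z \<le> norm (?T z)"
        using \<sigma>l(1) lo unfolding J_def by (rule norm_transpose_ge)
      then have "(\<sigma>l * norm z)\<^sup>2 \<le> (norm (?T z))\<^sup>2"
        using \<sigma>l by (intro power_mono) auto
      then show ?thesis by (simp add: a_def power_mult_distrib dot_square_norm)
    qed
    have Thi: "?T z \<bullet> ?T z \<le> a * \<kappa>\<^sup>2 * (z \<bullet> z)" for z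
    proof -
      have "norm (?T z) \<le> \<sigma>u * norm z"
        using hi unfolding J_def by (rule norm_transpose_le)
      then have "(norm (?T z))\<^sup>2 \<le> (\<sigma>u * norm z)\<^sup>2"
        by (intro power_mono) auto
      then show ?thesis by (simp add: power_mult_distrib dot_square_norm flip: b)
    qed
    have ab: "a \<le> a * \<kappa>\<^sup>2"
      using a \<kappa>1 by simp
    \<comment> \<open>This is \<open>- V' t / 2 - \<rho> * V t\<close>, with its terms sorted by
      whether they pass through the transposed Jacobian.\<close>
    have "0 \<le> \<gamma> * (?T ?f \<bullet> ?T ?f) + (- \<rho>) * (?f \<bullet> ?f) + \<delta> * (2 - \<delta>) * (?T ?f \<bullet> ?T ?q)
        + (- a) * (?f \<bullet> ?q) + ((\<epsilon> - \<rho>) * a) * (?q \<bullet> ?q)"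
      by (rule interpolated_form_nonneg[OF matrix_vector_mul_linear ab Tlo Thi])
        (use disc1 disc\<kappa> a in auto)
    moreover have "V' t = - 2 * (\<gamma> * (?T ?f \<bullet> ?T ?f) + \<delta> * (2 - \<delta>) * (?T ?f \<bullet> ?T ?q)
        - a * (?f \<bullet> ?q) + \<epsilon> * a * (?q \<bullet> ?q))"
      unfolding V'_def \<gamma>\<epsilon>
      by (simp add: inner_matrix_vector_transpose matrix_vector_right_distrib matrix_vector_mult_scaleR
          inner_add_right inner_diff_right inner_commute[of ?q ?f] algebra_simps)
    ultimately show ?thesis
      by (simp add: V_def algebra_simps)
  qed
  have "(norm (F (U t)))\<^sup>2 \<le> V t"
    using a by (simp add: V_def dot_square_norm)
  also have "\<dots> \<le> exp (- (2 * \<rho>) * t) * V 0"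
    using der le \<open>0 \<le> t\<close> by (rule exponential_decay)
  \<comment> \<open>\<open>V\<close> bounds the squared residual, so the square root halves its rate
    \<open>2 * \<rho>\<close>.\<close>
  also have "exp (- (2 * \<rho>) * t) = (exp (- (\<rho> * t)))\<^sup>2"
    by (simp flip: exp_double)
  finally have "norm (F (U t)) \<le> sqrt ((exp (- (\<rho> * t)))\<^sup>2 * V 0)"
    by (rule real_le_rsqrt)
  also have "\<dots> = exp (- (\<rho> * t)) * sqrt (V 0)"
    by (simp add: real_sqrt_mult)
  finally show ?thesis
    by (simp add: \<rho>_def V_def a_def dot_square_norm)
qed

text \<open>Finiteness of the supremum is expressed by \<open>bdd_above\<close>, because a real
  \<open>SUP\<close> is informative only for bounded families. In the first conjunct the rate
  \<open>r\<close> is chosen before the solution, while the constant \<open>C\<close> may depend on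
  it.\<close>

theorem theorem3:
  fixes F :: "real ^ 'n \<Rightarrow> real ^ 'n"
    and \<sigma>l \<sigma>u \<kappa> :: real
  assumes "continuously_differentiable F"
    and "\<sigma>l = (INF U. sigma_min (jacobian F (at U)))"
    and "bdd_above (range (\<lambda>U. sigma_max (jacobian F (at U))))"
    and "\<sigma>u = (SUP U. sigma_max (jacobian F (at U)))"
    and "0 < \<sigma>l" and "\<sigma>l \<le> \<sigma>u"
    and "\<kappa> = \<sigma>u / \<sigma>l"
  shows "(\<exists>\<gamma>>0. \<exists>\<epsilon>>0. \<exists>r>0. \<forall>U Q. pdhg_flow F \<gamma> \<epsilon> U Q \<longrightarrow>
            (\<exists>C. \<forall>t\<ge>0. norm (F (U t)) \<le> C * exp (- r * t))) \<and>
         (\<forall>\<delta> \<gamma> \<epsilon>. \<bar>\<delta>\<bar> < 1 / \<kappa> \<and> \<epsilon> = (1 - \<delta>) * \<kappa> \<and> \<gamma> = (1 - \<delta>) / \<kappa> \<longrightarrow>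
            (\<forall>U Q. pdhg_flow F \<gamma> \<epsilon> U Q \<longrightarrow>
              (\<forall>t\<ge>0. norm (F (U t)) \<le>
                exp (- ((1 - \<kappa> * \<bar>\<delta>\<bar>) * (3 - \<delta>) * (min (\<sigma>l\<^sup>2) 1 / (8 * \<kappa>)) * t)) *
                sqrt ((norm (F (U 0)))\<^sup>2 + \<sigma>l\<^sup>2 * (norm (Q 0))\<^sup>2))))"
proof -
  let ?J = "\<lambda>U. jacobian F (at U)"
  have lo: "\<sigma>l * norm x \<le> norm (?J U *v x)" for U x
  proof -
    have "bdd_below (range (\<lambda>U. sigma_min (?J U)))"
      by (rule bdd_belowI[of _ 0]) (auto simp: sigma_min_nonneg)
    then have "\<sigma>l \<le> sigma_min (?J U)"
      unfolding assms(2) by (rule cINF_lower) simp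
    then have "\<sigma>l * norm x \<le> sigma_min (?J U) * norm x"
      by (simp add: mult_right_mono)
    then show ?thesis
      using sigma_min_le[of "?J U" x] by linarith
  qed
  have hi: "norm (?J U *v x) \<le> \<sigma>u * norm x" for U x
  proof -
    have "sigma_max (?J U) * norm x \<le> \<sigma>u * norm x"
      unfolding assms(4) using assms(3) by (intro mult_right_mono cSUP_upper) auto
    then show ?thesis
      using sigma_max_ge[of "?J U" x] by linarith
  qed
  note decay = pdhg_flow_decay[OF assms(1,5,6) lo hi assms(7)]
  have \<kappa>: "0 < \<kappa>"
    using assms(5-7) by simp
  \<comment> \<open>The rate for \<delta> = 0, that is, for \<gamma> = 1 / \<kappa> and \<epsilon> =
    \<kappa>, which witnesses the existence claim.\<close>
  define r where "r = 3 * (min (\<sigma>l\<^sup>2) 1 / (8 * \<kappa>))"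
  have "0 < r"
    using assms(5) \<kappa> by (simp add: r_def)
  moreover have "\<exists>C. \<forall>t\<ge>0. norm (F (U t)) \<le> C * exp (- r * t)" if "pdhg_flow F (1 / \<kappa>) \<kappa> U Q" for U Q
  proof (intro exI allI impI)
    fix t :: real assume "0 \<le> t"
    have "norm (F (U t)) \<le> exp (- ((1 - \<kappa> * \<bar>0\<bar>) * (3 - 0) * (min (\<sigma>l\<^sup>2) 1 / (8 * \<kappa>)) * t)) *
        sqrt ((norm (F (U 0)))\<^sup>2 + \<sigma>l\<^sup>2 * (norm (Q 0))\<^sup>2)"
      by (rule decay[OF _ _ _ that \<open>0 \<le> t\<close>]) (use \<kappa> in simp_all)
    also have "- ((1 - \<kappa> * \<bar>0\<bar>) * (3 - 0) * (min (\<sigma>l\<^sup>2) 1 / (8 * \<kappa>)) * t) = - r * t"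
      by (simp add: r_def)
    finally show "norm (F (U t)) \<le> sqrt ((norm (F (U 0)))\<^sup>2 + \<sigma>l\<^sup>2 * (norm (Q 0))\<^sup>2) * exp (- r * t)"
      by (simp only: mult.commute)
  qed
  ultimately have "\<exists>r>0. \<forall>U Q. pdhg_flow F (1 / \<kappa>) \<kappa> U Q \<longrightarrow>
      (\<exists>C. \<forall>t\<ge>0. norm (F (U t)) \<le> C * exp (- r * t))"
    by blast
  moreover have "0 < 1 / \<kappa>"
    using \<kappa> by simp
  ultimately have "\<exists>\<gamma>>0. \<exists>\<epsilon>>0. \<exists>r>0. \<forall>U Q. pdhg_flow F \<gamma> \<epsilon> U Q \<longrightarrow>
      (\<exists>C. \<forall>t\<ge>0. norm (F (U t)) \<le> C * exp (- r * t))"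
    using \<kappa> by blast
  then show ?thesis
  proof (intro conjI allI impI)
    fix \<delta> \<gamma> \<epsilon> :: real and U Q :: "real \<Rightarrow> real ^ 'n" and t :: real
    assume "\<bar>\<delta>\<bar> < 1 / \<kappa> \<and> \<epsilon> = (1 - \<delta>) * \<kappa> \<and> \<gamma> = (1 - \<delta>) / \<kappa>" "pdhg_flow F \<gamma> \<epsilon> U Q" "0 \<le> t"
    then show "norm (F (U t)) \<le>
        exp (- ((1 - \<kappa> * \<bar>\<delta>\<bar>) * (3 - \<delta>) * (min (\<sigma>l\<^sup>2) 1 / (8 * \<kappa>)) * t)) *
          sqrt ((norm (F (U 0)))\<^sup>2 + \<sigma>l\<^sup>2 * (norm (Q 0))\<^sup>2)"
      by (elim conjE, intro decay)
  qed
qed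

end
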